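(* For every integer $m\ge 5$, $v(m)\ge m$, where $v(m)$ denotes the maximum number of vertices of an irreducible Tait colorable $m$-pole.
   Context: An $m$-pole ($m\ge 1$), or multipole, $M=(V,E,\mathcal{E})$ consists of a finite set $V=V(M)$ of vertices, a finite collection $E$ of edges (unordered pairs of vertices; parallel edges and loops may occur), and a set $\mathcal{E}=\{\epsilon_1,\dots,\epsilon_m\}$ of $m$ semiedges. Each semiedge is either incident to exactly one vertex, or is paired with another semiedge to form a free (isolated) edge, which has no vertices. All multipoles are cubic: for each vertex, the number of edges (loops counted twice) plus semiedges incident to it is $3$. A multipole may be disconnected, and $V$ may be empty. A Tait coloring of $M$ is a map $\phi:E\cup\mathcal{E}\to\{1,2,3\}$ such that the three edges/semiedges incident with any vertex receive distinct colors (so a multipole with a loop has none) and the two semiedges of any free edge receive the same color. $M$ is Tait colorable if it has a Tait coloring. $\mathrm{Col}(M)$ is the set of states of $M$, i.e. of tuples $(\phi(\epsilon_1),\dots,\phi(\epsilon_m))$ with $\phi$ a Tait coloring of $M$. An $m$-pole $M$ is reducible if there is an $m$-pole $N$ (with its semiedges numbered) such that $|V(N)|<|V(M)|$ and $\emptyset\ne\mathrm{Col}(N)\subseteq\mathrm{Col}(M)$; otherwise $M$ is irreducible. The maximum $v(m)$ is known to be finite. *)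

theory Defs
  imports "HOL-Library.Multiset"
begin

text \<open>
  In an \<open>m\<close>-pole the semiedges are numbered \<open>1, \<dots>, m\<close>.  Each one is attached either to a
  vertex (\<open>Vertex v\<close>) or, forming a free edge, to another semiedge (\<open>Semiedge j\<close>).
\<close>
datatype attachment = Vertex nat | Semiedge nat

text \<open>
  Vertices and edges are named by natural numbers; as both sets are finite this loses nothing.
  Edges are named so that parallel edges can be coloured differently.  The unordered pair of ends
  of an edge is a multiset of size 2, so a loop at \<open>v\<close> has the ends \<open>{#v, v#}\<close>.
\<close>
record multipole =
  verts :: "nat set"
  edges :: "nat set"
  ends :: "nat \<Rightarrow> nat multiset"
  attach :: "nat \<Rightarrow> attachment"

datatype link = Edge nat | Semi nat

definition m_pole :: "nat \<Rightarrow> multipole \<Rightarrow> bool" where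
  "m_pole m M \<longleftrightarrow>
     1 \<le> m \<and> finite (verts M) \<and> finite (edges M) \<and>
     (\<forall>e\<in>edges M. size (ends M e) = 2 \<and> set_mset (ends M e) \<subseteq> verts M) \<and>
     (\<forall>i\<in>{1..m}. case attach M i of
        Vertex v \<Rightarrow> v \<in> verts M
      | Semiedge j \<Rightarrow> j \<in> {1..m} \<and> j \<noteq> i \<and> attach M j = Semiedge i) \<and>
     (\<forall>v\<in>verts M.
        (\<Sum>e\<in>edges M. count (ends M e) v) + card {i \<in> {1..m}. attach M i = Vertex v} = 3)"

definition incident :: "nat \<Rightarrow> multipole \<Rightarrow> nat \<Rightarrow> link set" where
  "incident m M v =
     Edge ` {e \<in> edges M. v \<in># ends M e} \<union> Semi ` {i \<in> {1..m}. attach M i = Vertex v}"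

text \<open>
  A loop is incident twice with its vertex, so the three colours there cannot be distinct; as
  \<^term>\<open>incident m M v\<close> forgets multiplicities, loops have to be excluded separately.
\<close>
definition tait_coloring :: "nat \<Rightarrow> multipole \<Rightarrow> (link \<Rightarrow> nat) \<Rightarrow> bool" where
  "tait_coloring m M \<phi> \<longleftrightarrow>
     (\<forall>x \<in> Edge ` edges M \<union> Semi ` {1..m}. \<phi> x \<in> {1, 2, 3}) \<and>
     (\<forall>v\<in>verts M. (\<forall>e\<in>edges M. count (ends M e) v \<le> 1) \<and> inj_on \<phi> (incident m M v)) \<and>
     (\<forall>i\<in>{1..m}. \<forall>j\<in>{1..m}. attach M i = Semiedge j \<longrightarrow> \<phi> (Semi i) = \<phi> (Semi j))"

definition tait_colorable :: "nat \<Rightarrow> multipole \<Rightarrow> bool" where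
  "tait_colorable m M \<longleftrightarrow> (\<exists>\<phi>. tait_coloring m M \<phi>)"

definition Col :: "nat \<Rightarrow> multipole \<Rightarrow> nat list set" where
  "Col m M = {map (\<lambda>i. \<phi> (Semi i)) [1..<m+1] | \<phi>. tait_coloring m M \<phi>}"

definition reducible_pole :: "nat \<Rightarrow> multipole \<Rightarrow> bool" where
  "reducible_pole m M \<longleftrightarrow>
     (\<exists>N. m_pole m N \<and> card (verts N) < card (verts M) \<and> Col m N \<noteq> {} \<and> Col m N \<subseteq> Col m M)"

definition irreducible_orders :: "nat \<Rightarrow> nat set" where
  "irreducible_orders m =
     {card (verts M) | M. m_pole m M \<and> tait_colorable m M \<and> \<not> reducible_pole m M}"

definition max_irreducible_order :: "nat \<Rightarrow> nat" where
  "max_irreducible_order m = Max (irreducible_orders m)"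

text \<open>
  The maximum is over a finite set: irreducible colourable multipoles with equal sets of states
  have equally many vertices, and there are finitely many sets of states.
\<close>
lemma finite_irreducible_orders: "finite (irreducible_orders m)"
proof -
  define P where "P M \<longleftrightarrow> m_pole m M \<and> tait_colorable m M \<and> \<not> reducible_pole m M" for M
  have ne: "Col m M \<noteq> {}" if "P M" for M
    using that by (auto simp: P_def tait_colorable_def Col_def)
  have le: "card (verts M) \<le> card (verts N)" if "P M" "P N" "Col m M = Col m N" for M N
  proof (rule ccontr)
    assume "\<not> card (verts M) \<le> card (verts N)"
    then have "reducible_pole m M"
      using that ne[of N] unfolding reducible_pole_def P_def by (intro exI[of _ N]) simp
    with that show False by (simp add: P_def)
  qed
  define g where "g S = card (verts (SOME M. P M \<and> Col m M = S))" for S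
  have "card (verts M) = g (Col m M)" if "P M" for M
  proof -
    define N where "N = (SOME N. P N \<and> Col m N = Col m M)"
    have "P N \<and> Col m N = Col m M"
      unfolding N_def by (rule someI[of _ M]) (simp add: that)
    then have "card (verts M) = card (verts N)"
      by (simp add: le that antisym)
    then show ?thesis by (simp add: g_def N_def)
  qed
  moreover have "Col m M \<in> Pow {xs. set xs \<subseteq> {1, 2, 3} \<and> length xs = m}" for M
  proof -
    have "set (map (\<lambda>i. \<phi> (Semi i)) [1..<m+1]) \<subseteq> {1, 2, 3} \<and>
        length (map (\<lambda>i. \<phi> (Semi i)) [1..<m+1]) = m" if "tait_coloring m M \<phi>" for \<phi>
    proof -
      have "\<phi> (Semi i) \<in> {1, 2, 3}" if "i \<in> {1..m}" for i
        using \<open>tait_coloring m M \<phi>\<close> that unfolding tait_coloring_def by blast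
      moreover have "set [1..<m+1] = {1..m}" by auto
      ultimately show ?thesis by (simp only: set_map image_subset_iff) simp
    qed
    then have "xs \<in> {xs. set xs \<subseteq> {1, 2, 3} \<and> length xs = m}" if "xs \<in> Col m M" for xs
      using that unfolding Col_def by (elim CollectE exE conjE) (simp only: mem_Collect_eq)
    then show ?thesis by (intro PowI subsetI)
  qed
  ultimately have "irreducible_orders m \<subseteq> g ` Pow {xs. set xs \<subseteq> {1, 2, 3} \<and> length xs = m}"
    unfolding irreducible_orders_def P_def[symmetric]
    by (intro subsetI, elim CollectE exE conjE) (simp only: imageI)
  moreover have "finite (Pow {xs :: nat list. set xs \<subseteq> {1, 2, 3} \<and> length xs = m})"
    by (simp add: finite_lists_length_eq)
  ultimately show ?thesis
    by (meson finite_imageI finite_subset)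
qed

end

theory Submission
  imports Defs "HOL-Library.Z2" "HOL-Library.Product_Plus"
begin

text \<open>
  Every \<open>m\<close>-pole \<open>N\<close> with \<open>\<emptyset> \<noteq> Col N \<subseteq> Col C\<close>, where \<open>C\<close> is the \<open>m\<close>-cycle with a semiedge at each
  vertex, has at least \<open>m\<close> vertices; the smallest such \<open>N\<close> is therefore irreducible.  Identify the
  colours with the nonzero elements of the Klein four-group.  A state of \<open>C\<close> is then a sequence with
  sum 0 whose partial sums miss some group element, namely the colour of the edge that closes the
  cycle.  If \<open>N\<close> had fewer than \<open>m\<close> vertices, then two semiedges \<open>i < j\<close> would form a free edge or
  share a vertex, so their colours would be equal in all states or distinct in all states.  Switching
  the Kempe chain that joins them translates the partial sums taken between \<open>i\<close> and \<open>j\<close>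
  and fixes the others, and both before and after the translation an element is missed.  This forces
  the states to be nearly constant on the two arcs into which \<open>i\<close> and \<open>j\<close> cut the circle, which is
  incompatible with switching a further Kempe chain.
\<close>

section \<open>The Klein four-group\<close>

type_synonym klein = "bit \<times> bit"

lemma klein_add_self [simp]: "x + x = (0 :: klein)"
  by (cases x) (simp add: zero_prod_def)

lemma klein_add_left_self [simp]: "x + (x + y) = (y :: klein)"
  by (simp add: add.assoc[symmetric])

lemma klein_add_eq_0_iff: "x + y = 0 \<longleftrightarrow> x = (y :: klein)"
  by (metis add_cancel_right_right klein_add_left_self)

lemma klein_add_eq_iff: "x + y = z \<longleftrightarrow> x = y + (z :: klein)"
  by (metis add.commute klein_add_left_self)

lemma klein_sum_nonzero:
  fixes a b c :: klein
  assumes "a \<noteq> 0" "b \<noteq> 0" "c \<noteq> 0" "a \<noteq> b" "a \<noteq> c" "b \<noteq> c"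
  shows "a + b + c = 0"
proof -
  obtain a1 a2 b1 b2 c1 c2 where [simp]: "a = (a1, a2)" "b = (b1, b2)" "c = (c1, c2)"
    by (metis prod.exhaust)
  show ?thesis using assms
    by (cases a1; cases a2; cases b1; cases b2; cases c1; cases c2) (simp_all add: zero_prod_def)
qed

text \<open>Translating by \<open>w\<close> turns the other three elements into the three nonzero
  ones, and \<open>w\<close> is added an odd number of times.\<close>

lemma klein_sum_distinct:
  fixes w x y z :: klein
  assumes "w \<noteq> x" "w \<noteq> y" "w \<noteq> z" "x \<noteq> y" "x \<noteq> z" "y \<noteq> z"
  shows "w + x + y + z = 0"
proof -
  have "(w + x) + (w + y) + (w + z) = 0"
    by (rule klein_sum_nonzero) (use assms in \<open>auto simp: klein_add_eq_0_iff\<close>)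
  then show ?thesis by (simp add: ac_simps)
qed

lemma klein_other:
  fixes \<alpha> :: klein
  obtains \<beta> where "\<beta> \<noteq> 0" "\<beta> \<noteq> \<alpha>"
  by (metis fst_conv fst_zero snd_conv snd_zero zero_neq_one)

text \<open>The elements \<open>g\<close>, \<open>g + \<alpha>\<close>, \<open>y\<close>,
  \<open>z\<close> exhaust the group and hence sum to 0. So a set that misses both \<open>y\<close>
  and \<open>z\<close> has only one possible nonzero difference.\<close>

lemma klein_pair:
  fixes g \<alpha> y z :: klein
  assumes "y \<noteq> z" "g \<noteq> y" "g \<noteq> z" "g + \<alpha> \<noteq> y" "g + \<alpha> \<noteq> z" "\<alpha> \<noteq> 0"
  shows "\<alpha> = y + z"
proof -
  have "g + (g + \<alpha>) + y + z = 0"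
    by (rule klein_sum_distinct) (use assms in auto)
  then have "\<alpha> + y + z = 0" by simp
  then show ?thesis by (simp add: klein_add_eq_0_iff add.assoc)
qed

section \<open>Group elements missed by the partial sums on two arcs\<close>

text \<open>\<open>P\<close> and \<open>Q\<close> stand for the partial sums on the two arcs,
  \<open>a\<close> and \<open>b\<close> for the colours of the semiedges \<open>i\<close> and
  \<open>j\<close>, and \<open>x\<close> and \<open>y\<close> for the partial sums just before them.
  Then \<open>x + a + y\<close> is the sum of the colours strictly between \<open>i\<close> and
  \<open>j\<close>. The state itself misses \<open>z0\<close>; the state switched by
  \<open>a + b\<close> at \<open>i\<close> and \<open>j\<close> misses \<open>z1\<close>.\<close>

lemma klein_distinct_arcs:
  fixes P Q :: "klein set"
  assumes ab: "a \<noteq> 0" "b \<noteq> 0" "a \<noteq> b"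
    and z0: "z0 \<notin> P" "z0 \<notin> Q" and z1: "z1 \<notin> Q" "z1 + (a + b) \<notin> P"
    and x: "x \<in> Q" "x + a \<in> P" and y: "y \<in> P" "y + b \<in> Q"
  shows "x + a + y \<noteq> 0 \<Longrightarrow> g \<in> P \<Longrightarrow> g + \<alpha> \<in> P \<Longrightarrow> \<alpha> \<noteq> 0 \<Longrightarrow> \<alpha> = x + a + y"
    and "x + a = y \<Longrightarrow> x + b \<notin> P"
proof -
  show "\<alpha> = x + a + y" if d: "x + a + y \<noteq> 0" and g: "g \<in> P" "g + \<alpha> \<in> P" "\<alpha> \<noteq> 0"
  proof (cases "z0 = z1 + (a + b)")
    case False
    \<comment> \<open>\<open>P\<close> misses two elements, so it has one nonzero difference;
      \<open>x + a\<close> and \<open>y\<close> lie in \<open>P\<close> and realise it.\<close>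
    have "\<alpha> = z0 + (z1 + (a + b))"
      by (rule klein_pair[of _ _ g]) (use False g z0 z1 in auto)
    moreover have "x + a + y = z0 + (z1 + (a + b))"
    proof (rule klein_pair[of _ _ "x + a"])
      have "x + a + (x + a + y) = y" by (rule klein_add_left_self)
      then show "x + a + (x + a + y) \<noteq> z0" "x + a + (x + a + y) \<noteq> z1 + (a + b)"
        using y z0 z1 by auto
      show "x + a \<noteq> z0" "x + a \<noteq> z1 + (a + b)" using x z0 z1 by metis+
    qed (use False d in simp_all)
    ultimately show ?thesis by simp
  next
    case True
    \<comment> \<open>Now \<open>Q\<close> misses the two elements \<open>z0\<close> and
      \<open>z1\<close>. Its elements \<open>x\<close> and \<open>y + b\<close> force
      \<open>y = x + b\<close>, which leaves no room for \<open>z0\<close>, so this case is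
      contradictory.\<close>
    then have z1': "z1 = z0 + (a + b)" by (metis klein_add_eq_iff add.commute)
    have ne: "z0 \<noteq> z1" using ab unfolding z1' by (auto simp: klein_add_eq_0_iff)
    have "x + y + b = 0 \<or> x + y + b = z0 + z1"
    proof (cases "x + y + b = 0")
      case False
      have "x + (x + y + b) = y + b" by (simp add: add.assoc)
      then have "x + (x + y + b) \<noteq> z0" "x + (x + y + b) \<noteq> z1"
        using y z0 z1 by metis+
      moreover have "x \<noteq> z0" "x \<noteq> z1" using x z0 z1 by metis+
      ultimately have "x + y + b = z0 + z1"
        by (intro klein_pair[of _ _ x] ne False)
      then show ?thesis ..
    qed simp
    then have "x + y + b = 0 \<or> x + y + b = a + b" by (simp add: z1')
    then have "y = x + b" using d
      by (metis add.commute add.left_commute klein_add_eq_iff klein_add_self)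
    have "z0 + x = a \<or> z0 + x = b"
    proof (rule ccontr)
      assume "\<not> ?thesis"
      then have "z0 + x + (0 :: klein) + a + b = 0"
        using x z0 z1 ab by (intro klein_sum_distinct) (auto simp: klein_add_eq_0_iff)
      then have "x = z0 + (a + b)" 
        by (metis add.assoc add.right_neutral add.commute klein_add_eq_0_iff klein_add_left_self)
      with x z1 z1' show False by simp
    qed
    then have "x + a = z0 \<or> x + b = z0"
      by (metis add.commute klein_add_eq_iff)
    with x y z0 \<open>y = x + b\<close> show ?thesis by auto
  qed
  show "x + b \<notin> P" if d: "x + a = y"
  proof
    assume "x + b \<in> P"
    \<comment> \<open>The elements \<open>x + a\<close>, \<open>x + b\<close> of \<open>P\<close>
      and \<open>x\<close>, \<open>x + a + b\<close> of \<open>Q\<close> are the whole group, so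
      \<open>z0\<close> cannot exist.\<close>
    have Q: "x + a + b \<in> Q" using y d by simp
    have "z0 + x + (x + a) + (x + b) = 0 \<or> z0 = x"
      using \<open>x + b \<in> P\<close> x z0 ab by (intro disjCI klein_sum_distinct) auto
    then have "z0 = x + a + b \<or> z0 = x"
      by (metis (no_types, opaque_lifting) add.assoc add.commute klein_add_eq_0_iff klein_add_left_self)
    with Q z0 x show False by auto
  qed
qed

text \<open>The choices \<open>\<delta> = 0\<close> and \<open>\<delta> = x + y1\<close> in
  \<open>miss\<close> give two elements missed by \<open>P\<close>, hence a single nonzero
  difference in \<open>P\<close>. If \<open>Q\<close> had the same difference, some permitted
  translate of \<open>P\<close> would cover the group together with \<open>Q\<close>.\<close>

lemma klein_equal_arcs:
  fixes P Q :: "klein set"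
  assumes miss: "\<And>\<delta>. \<delta> \<noteq> u \<Longrightarrow> \<exists>z. z \<notin> Q \<and> z + \<delta> \<notin> P"
    and u: "u \<noteq> 0" and x: "x \<in> Q" "x + u \<in> P"
    and g: "g \<in> P" "g + \<alpha> \<in> P" "\<alpha> \<noteq> 0"
  shows "h \<in> P \<Longrightarrow> h + \<beta> \<in> P \<Longrightarrow> \<beta> \<noteq> 0 \<Longrightarrow> \<alpha> = \<beta>"
    and "h \<in> Q \<Longrightarrow> h + \<alpha> \<notin> Q"
proof -
  obtain y1 where y1: "y1 \<notin> P"
    using miss[of 0] u by auto
  then have "x + y1 \<noteq> u" using x by (metis klein_add_left_self)
  then obtain z where "z \<notin> Q" "z + (x + y1) \<notin> P" using miss by blast
  then obtain y2 where y2: "y2 \<notin> P" "y2 \<noteq> y1"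
    using x by (metis add.assoc add.commute klein_add_eq_0_iff klein_add_left_self)
  show "\<alpha> = \<beta>" if "h \<in> P" "h + \<beta> \<in> P" "\<beta> \<noteq> 0"
    using klein_pair[of y1 y2 g \<alpha>] klein_pair[of y1 y2 h \<beta>] that g y1 y2 by metis
  show "h + \<alpha> \<notin> Q" if "h \<in> Q"
  proof
    assume "h + \<alpha> \<in> Q"
    \<comment> \<open>Two elements lie outside \<open>{h, h + \<alpha>}\<close>, and at most one of
      them violates \<open>g + k \<noteq> u\<close>. The translate of \<open>P\<close> by
      \<open>g + k\<close> contains \<open>k\<close> and \<open>k + \<alpha>\<close>.\<close>
    obtain k where k: "k \<noteq> h" "k \<noteq> h + \<alpha>" "g + k \<noteq> u"
    proof -
      obtain \<beta> where \<beta>: "\<beta> \<noteq> 0" "\<beta> \<noteq> \<alpha>" by (rule klein_other)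
      show ?thesis
      proof (cases "g + (h + \<beta>) = u")
        case True
        then show ?thesis using \<beta> g(3)
          by (intro that[of "h + \<beta> + \<alpha>"]) (auto simp: add.assoc klein_add_eq_0_iff)
      next
        case False
        then show ?thesis using \<beta> by (intro that[of "h + \<beta>"]) auto
      qed
    qed
    then obtain z where z: "z \<notin> Q" "z + (g + k) \<notin> P" using miss by blast
    have "z \<noteq> k" using z g by (auto simp: add.left_commute[of k])
    moreover have "z \<noteq> k + \<alpha>" using z g by (auto simp: ac_simps)
    ultimately have "\<alpha> = h + (h + \<alpha>)" and "z + k + h + (h + \<alpha>) = 0"
      using z \<open>h \<in> Q\<close> \<open>h + \<alpha> \<in> Q\<close> k g
      by (simp, intro klein_sum_distinct) auto
    then have "z = k + \<alpha>"
      by (metis add.assoc klein_add_eq_0_iff)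
    with \<open>z \<noteq> k + \<alpha>\<close> show False by simp
  qed
qed

section \<open>States of the cycle\<close>

text \<open>If \<open>z\<close> is the colour of the edge closing the cycle, the edge after position
  \<open>k\<close> has colour \<open>z + sum s {1..k}\<close>, which must be nonzero. The index 0 is
  included, so \<open>z\<close> is nonzero as well.\<close>

definition cyclic_state :: "nat \<Rightarrow> (nat \<Rightarrow> klein) \<Rightarrow> bool" where
  "cyclic_state m s \<longleftrightarrow>
     (\<forall>k\<in>{1..m}. s k \<noteq> 0) \<and> sum s {1..m} = 0 \<and> (\<exists>z. \<forall>k\<le>m. sum s {1..k} \<noteq> z)"

definition switched :: "nat \<Rightarrow> nat \<Rightarrow> nat \<Rightarrow> klein \<Rightarrow> (nat \<Rightarrow> klein) \<Rightarrow> (nat \<Rightarrow> klein) \<Rightarrow> bool" where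
  "switched m p q \<delta> s t \<longleftrightarrow> (\<forall>k\<in>{1..m}. t k = (if k = p \<or> k = q then s k + \<delta> else s k))"

text \<open>
  Exchanging the two nonzero elements other than \<open>\<delta>\<close> is addition of \<open>\<delta>\<close>, so the following says that
  each semiedge whose colour is not \<open>\<delta>\<close> is an end of a switchable Kempe chain avoiding colour \<open>\<delta>\<close>.
\<close>
definition kempe_closed :: "nat \<Rightarrow> (nat \<Rightarrow> klein) set \<Rightarrow> bool" where
  "kempe_closed m S \<longleftrightarrow>
     (\<forall>s\<in>S. \<forall>p\<in>{1..m}. \<forall>\<delta>. \<delta> \<noteq> 0 \<longrightarrow> s p \<noteq> \<delta> \<longrightarrow>
       (\<exists>q\<in>{1..m}. q \<noteq> p \<and> s q \<noteq> \<delta> \<and> (\<exists>t\<in>S. switched m p q \<delta> s t)))"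

lemma kempe_closedE:
  assumes "kempe_closed m S" "s \<in> S" "p \<in> {1..m}" "\<delta> \<noteq> 0" "s p \<noteq> \<delta>"
  obtains q t where "q \<in> {1..m}" "q \<noteq> p" "s q \<noteq> \<delta>" "t \<in> S" "switched m p q \<delta> s t"
  using assms unfolding kempe_closed_def by metis

lemma sum_switched:
  assumes t: "switched m p q \<delta> s t" and "p \<noteq> q" and A: "A \<subseteq> {1..m}"
  shows "sum t A = sum s A + (if p \<in> A then \<delta> else 0) + (if q \<in> A then \<delta> else 0)"
proof -
  have [simp]: "finite A" using A finite_subset by auto
  have "sum t A = (\<Sum>k\<in>A. s k + (if k = p then \<delta> else 0) + (if k = q then \<delta> else 0))"
    by (rule sum.cong) (use t A \<open>p \<noteq> q\<close> in \<open>auto simp: switched_def subset_iff\<close>)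
  then show ?thesis by (simp add: sum.distrib)
qed

text \<open>The switch shifts exactly the partial sums with \<open>i \<le> k < j\<close>, since the
  two shifts cancel from \<open>j\<close> on.\<close>

lemma missed_point_switched:
  assumes t: "cyclic_state m t" "switched m i j \<delta> s t" and ij: "1 \<le> i" "i < j" "j \<le> m"
  shows "\<exists>z. z \<notin> (\<lambda>k. sum s {1..k}) ` ({0..<i} \<union> {j..m}) \<and> z + \<delta> \<notin> (\<lambda>k. sum s {1..k}) ` {i..<j}"
proof -
  obtain z where z: "\<And>k. k \<le> m \<Longrightarrow> sum t {1..k} \<noteq> z"
    using t by (auto simp: cyclic_state_def)
  have s: "sum t {1..k} = sum s {1..k} + (if i \<le> k \<and> k < j then \<delta> else 0)" if "k \<le> m" for k
    using sum_switched[OF t(2), of "{1..k}"] ij that by (auto simp: add.assoc)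
  have "z \<noteq> sum s {1..k}" if "k \<in> {0..<i} \<union> {j..m}" for k
    using z[of k] s[of k] that ij by auto
  moreover have "z + \<delta> \<noteq> sum s {1..k}" if "k \<in> {i..<j}" for k
    using z[of k] s[of k] that ij by (auto simp: klein_add_eq_iff add.commute)
  ultimately show ?thesis by blast
qed

section \<open>Two semiedges whose colours always differ\<close>

text \<open>
  \<open>P\<close> and \<open>Q\<close> play the role of the two arcs between \<open>i\<close> and \<open>j\<close>, and \<open>f\<close>, \<open>g\<close> are positions
  on them next to \<open>i\<close> or \<open>j\<close>.  The assumptions are symmetric in the two arcs.
\<close>
locale distinct_pair =
  fixes m :: nat and S :: "(nat \<Rightarrow> klein) set" and i j :: nat and P Q :: "nat set" and f g :: nat
  assumes closed: "kempe_closed m S"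
    and ij: "i \<in> {1..m}" "j \<in> {1..m}" "i \<noteq> j" "i \<notin> P \<union> Q" "j \<notin> P \<union> Q"
    and PQ: "P \<union> Q \<union> {i, j} = {1..m}" "P \<inter> Q = {}"
    and nonzero: "s \<in> S \<Longrightarrow> k \<in> {1..m} \<Longrightarrow> s k \<noteq> 0"
    and distinct: "s \<in> S \<Longrightarrow> s i \<noteq> s j"
    and total: "s \<in> S \<Longrightarrow> sum s P + sum s Q = s i + s j"
    and constP: "s \<in> S \<Longrightarrow> sum s P \<noteq> 0 \<Longrightarrow> k \<in> P \<Longrightarrow> s k = sum s P"
    and constQ: "s \<in> S \<Longrightarrow> sum s Q \<noteq> 0 \<Longrightarrow> k \<in> Q \<Longrightarrow> s k = sum s Q"
    and f: "P \<noteq> {} \<Longrightarrow> f \<in> P" "s \<in> S \<Longrightarrow> P \<noteq> {} \<Longrightarrow> sum s P = 0 \<Longrightarrow> s f \<noteq> s i + s j"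
    and g: "Q \<noteq> {} \<Longrightarrow> g \<in> Q" "s \<in> S \<Longrightarrow> Q \<noteq> {} \<Longrightarrow> sum s Q = 0 \<Longrightarrow> s g \<noteq> s i + s j"
begin

lemma subset: "P \<subseteq> {1..m}" "Q \<subseteq> {1..m}"
  using PQ by auto

text \<open>The chain from \<open>p\<close> avoiding the colour \<open>s i + s j\<close> has no
  possible end. Ending at \<open>i\<close> or \<open>j\<close> would make their colours equal;
  ending in \<open>P\<close> would keep the sum of \<open>P\<close> but change \<open>s p\<close>;
  ending in \<open>Q\<close> would change the sum of \<open>P\<close> but not the colour of
  \<open>p'\<close>.\<close>

lemma both_odd_False:
  assumes s: "s \<in> S" and odd: "sum s P \<noteq> 0" "sum s Q \<noteq> 0" and p: "p \<in> P" "p' \<in> P" "p \<noteq> p'"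
  shows False
proof -
  define \<delta> where "\<delta> = s i + s j"
  have \<delta>: "\<delta> \<noteq> 0" using distinct[OF s] by (simp add: \<delta>_def klein_add_eq_0_iff)
  have "sum s P \<noteq> \<delta>" using total[OF s] odd(2) by (auto simp: \<delta>_def)
  then have "s p \<noteq> \<delta>" using constP[OF s odd(1) p(1)] by simp
  with \<delta> obtain q t where q: "q \<in> {1..m}" "q \<noteq> p" "s q \<noteq> \<delta>" and t: "t \<in> S" "switched m p q \<delta> s t"
    using kempe_closedE[OF closed s] p subset by blast
  have tk: "t k = (if k = p \<or> k = q then s k + \<delta> else s k)" if "k \<in> {1..m}" for k
    using t that by (auto simp: switched_def)
  have pij: "p \<noteq> i" "p \<noteq> j" "p \<in> {1..m}" "p' \<in> {1..m}" using p ij subset by auto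
  have sumP: "sum t P = sum s P + \<delta> + (if q \<in> P then \<delta> else 0)"
    using sum_switched[OF t(2) _ subset(1)] q p by auto
  consider "q = i" | "q = j" | "q \<in> P" | "q \<in> Q" using q(1) PQ(1) by blast
  then show False
  proof cases
    case 1
    then have "t i = t j" using tk[OF ij(1)] tk[OF ij(2)] pij ij(3) by (simp add: \<delta>_def)
    then show False using distinct t by blast
  next
    case 2
    then have "t i = t j" using tk[OF ij(1)] tk[OF ij(2)] pij ij(3) by (simp add: \<delta>_def ac_simps)
    then show False using distinct t by blast
  next
    case 3
    then have "sum t P = sum s P" using sumP by (simp add: add.assoc)
    then have "t p = s p" using constP s t odd p by metis
    then show False using tk[of p] pij \<delta> by simp
  next
    case 4
    then have "sum t P = sum s P + \<delta>" using sumP PQ by auto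
    moreover from this have "sum t P \<noteq> 0"
      using total[OF s] odd by (metis \<delta>_def klein_add_eq_0_iff klein_add_eq_iff add_cancel_right_right)
    ultimately have "t p' = s p' + \<delta>" using constP s t odd p by metis
    moreover have "p' \<noteq> q" using 4 p PQ by auto
    ultimately show False using tk[of p'] pij p \<delta> by simp
  qed
qed

text \<open>\<open>Q\<close> is constant of colour \<open>s i + s j\<close>. The chain from
  \<open>p\<close> avoiding the colour \<open>s b\<close> ends neither at \<open>b\<close> nor in
  \<open>Q\<close>, and after the switch constancy on \<open>Q\<close> fails if \<open>Q\<close> has
  another element. For nonempty \<open>P\<close> the chain ends at \<open>a\<close>, and the
  condition on \<open>f\<close> in the new state becomes \<open>s f \<noteq> s a\<close>.\<close>

lemma chain_from_odd_arc:
  assumes s: "s \<in> S" and sum: "sum s P = 0" and p: "p \<in> Q"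
    and ab: "(a = i \<and> b = j) \<or> (a = j \<and> b = i)"
  shows "Q = {p}" and "P \<noteq> {} \<Longrightarrow> s f \<noteq> s a"
proof -
  define \<delta> where "\<delta> = s b"
  have abm: "a \<in> {1..m}" "b \<in> {1..m}" "a \<noteq> b" "a \<notin> P \<union> Q" "b \<notin> P \<union> Q" "s a + s b = s i + s j"
    and PQab: "P \<union> Q \<union> {a, b} = {1..m}"
    using ab ij PQ by (auto simp: add.commute)
  have \<delta>: "\<delta> \<noteq> 0" "s a \<noteq> \<delta>" using nonzero[OF s] distinct[OF s] abm ab by (auto simp: \<delta>_def)
  have sumQ: "sum s Q = s a + \<delta>" using total[OF s] sum abm by (simp add: \<delta>_def)
  then have Q0: "sum s Q \<noteq> 0" using \<delta> by (simp add: klein_add_eq_0_iff)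
  have sQ: "s k = s a + \<delta>" if "k \<in> Q" for k using constQ[OF s Q0 that] sumQ by simp
  have "s p \<noteq> \<delta>" using sQ[OF p] nonzero[OF s abm(1)] by simp
  with \<delta> obtain q t where q: "q \<in> {1..m}" "q \<noteq> p" "s q \<noteq> \<delta>" and t: "t \<in> S" "switched m p q \<delta> s t"
    using kempe_closedE[OF closed s] p subset by blast
  have tk: "t k = (if k = p \<or> k = q then s k + \<delta> else s k)" if "k \<in> {1..m}" for k
    using t that by (auto simp: switched_def)
  have pm: "p \<in> {1..m}" "p \<noteq> a" "p \<noteq> b" "p \<notin> P" using p abm subset PQ by auto
  have tp: "t p = s a" using tk[of p] pm sQ[OF p] by (simp add: add.assoc)
  have qb: "q \<noteq> b" using q by (auto simp: \<delta>_def)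
  then have tb: "t b = \<delta>" using tk[of b] abm pm by (simp add: \<delta>_def)
  have sumtP: "sum t P = (if q \<in> P then \<delta> else 0)"
    using sum_switched[OF t(2) _ subset(1)] q pm sum by auto
  have sumtQ: "sum t Q = s a + (if q \<in> Q then \<delta> else 0)"
    using sum_switched[OF t(2) _ subset(2)] q p sumQ by (auto simp: add.assoc)
  have sa: "s a \<noteq> 0" using nonzero s abm by blast
  have "q \<notin> Q"
  proof
    assume "q \<in> Q"
    then have "sum t Q \<noteq> 0" using sumtQ \<delta> by (auto simp: klein_add_eq_0_iff)
    then have "t p = s a + \<delta>" using constQ[OF t(1) _ p] sumtQ \<open>q \<in> Q\<close> by simp
    with tp \<delta> show False by simp
  qed
  have tQ: "t k = s a" if "k \<in> Q" for k
    using constQ[OF t(1) _ that] sumtQ sa \<open>q \<notin> Q\<close> by simp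
  show "Q = {p}"
  proof (rule ccontr)
    assume "Q \<noteq> {p}"
    then obtain k where "k \<in> Q" "k \<noteq> p" using p by blast
    then have "s a = s k" using tk[of k] tQ[of k] \<open>q \<notin> Q\<close> subset by (auto split: if_splits)
    then show False using sQ \<open>k \<in> Q\<close> \<delta> by simp
  qed
  show "s f \<noteq> s a" if "P \<noteq> {}"
  proof (cases "q \<in> P")
    case True
    then have "t q = \<delta>" using constP[OF t(1) _ True] sumtP \<delta> by simp
    then have "s q = 0" using tk[of q] q by simp
    then show ?thesis using nonzero s q by blast
  next
    case False
    then have "q = a" using q PQab \<open>q \<notin> Q\<close> qb by blast
    then have "t a = s a + \<delta>" using tk[of a] abm by simp
    then have "t a + t b = s a" using tb by (simp add: add.assoc)
    moreover have "t a + t b = t i + t j" using ab by (auto simp: add.commute)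
    moreover have "t f = s f"
      using tk[of f] f(1)[OF that] False pm subset by auto
    ultimately show ?thesis using f(2)[OF t(1) that] sumtP False by simp
  qed
qed

text \<open>Both choices of \<open>a\<close> in \<open>chain_from_odd_arc\<close>, together with the
  condition on \<open>f\<close>, exclude \<open>s i\<close>, \<open>s j\<close> and
  \<open>s i + s j\<close> as the value of \<open>s f\<close>. These are all the nonzero
  elements.\<close>

lemma even_arc_False:
  assumes s: "s \<in> S" and sum: "sum s P = 0" and big: "card P + card Q \<ge> 2"
  shows False
proof -
  have "sum s Q \<noteq> 0" using total[OF s] sum distinct[OF s] by (simp add: klein_add_eq_0_iff)
  then obtain p where p: "p \<in> Q" by (metis ex_in_conv sum.empty)
  from chain_from_odd_arc[OF s sum p, of i j] chain_from_odd_arc[OF s sum p, of j i]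
  have "Q = {p}" "P \<noteq> {} \<Longrightarrow> s f \<noteq> s i" "P \<noteq> {} \<Longrightarrow> s f \<noteq> s j" by simp_all
  moreover have "P \<noteq> {}" using big \<open>Q = {p}\<close> by auto
  moreover from this have "s f \<noteq> s i + s j" "f \<in> P" using f s sum by auto
  moreover have "s f \<noteq> 0" "s i \<noteq> 0" "s j \<noteq> 0"
    using nonzero[OF s] ij \<open>f \<in> P\<close> subset by auto
  ultimately have "s f + (s i + s j) + s i + s j = 0"
    using distinct[OF s] by (intro klein_sum_distinct) (auto)
  then have "s f = 0" by (simp add: ac_simps)
  with \<open>s f \<noteq> 0\<close> show False by simp
qed

end

sublocale distinct_pair \<subseteq> opposite: distinct_pair m S i j Q P g f
proof
  show "sum s Q + sum s P = s i + s j" if "s \<in> S" for s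
    using total[OF that] by (simp add: add.commute)
qed (use closed ij PQ nonzero distinct constP constQ f g in \<open>auto\<close>)

lemma (in distinct_pair) contradiction:
  assumes "s \<in> S" and big: "card P + card Q \<ge> 3"
  shows False
proof -
  have "sum s P \<noteq> 0" "sum s Q \<noteq> 0"
    using even_arc_False opposite.even_arc_False assms by auto
  moreover have "card P \<ge> 2 \<or> card Q \<ge> 2" using big by linarith
  then have "(\<exists>p\<in>P. \<exists>p'\<in>P. p \<noteq> p') \<or> (\<exists>p\<in>Q. \<exists>p'\<in>Q. p \<noteq> p')"
    by (metis One_nat_def card_le_Suc0_iff_eq finite_subset finite_atLeastAtMost subset
        not_less_eq_eq numeral_2_eq_2)
  ultimately show False
    using both_odd_False opposite.both_odd_False assms by blast
qed

section \<open>Two semiedges whose colours always agree\<close>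

locale equal_pair =
  fixes m :: nat and S :: "(nat \<Rightarrow> klein) set" and i j :: nat and P Q :: "nat set"
  assumes closed: "kempe_closed m S"
    and ij: "i \<in> {1..m}" "j \<in> {1..m}" "i \<noteq> j" "i \<notin> P \<union> Q" "j \<notin> P \<union> Q"
    and PQ: "P \<union> Q \<union> {i, j} = {1..m}" "P \<inter> Q = {}"
    and nonzero: "s \<in> S \<Longrightarrow> k \<in> {1..m} \<Longrightarrow> s k \<noteq> 0"
    and equal: "s \<in> S \<Longrightarrow> s i = s j"
    and constP: "s \<in> S \<Longrightarrow> k \<in> P \<Longrightarrow> l \<in> P \<Longrightarrow> s k = s l"
    and constQ: "s \<in> S \<Longrightarrow> k \<in> Q \<Longrightarrow> l \<in> Q \<Longrightarrow> s k = s l"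
    and differ: "s \<in> S \<Longrightarrow> k \<in> P \<Longrightarrow> l \<in> Q \<Longrightarrow> s k \<noteq> s l"
begin

text \<open>The colour \<open>\<delta>\<close> is chosen so that the switch gives \<open>p\<close>
  the colour of \<open>Q\<close>, if \<open>Q\<close> is nonempty. The chain cannot end at
  \<open>i\<close> or \<open>j\<close>, as these keep a common colour. If it ends in
  \<open>P\<close>, constancy leaves at most two elements in \<open>P\<close>, so \<open>Q\<close>
  is nonempty and \<open>p\<close> acquires its colour; if it ends in \<open>Q\<close>, then
  \<open>p\<close> changes but \<open>p'\<close> does not.\<close>

lemma long_arc_False:
  assumes s: "s \<in> S" and p: "p \<in> P" "p' \<in> P" "p \<noteq> p'" and big: "card P + card Q \<ge> 3"
  shows False
proof -
  have sub: "P \<subseteq> {1..m}" "Q \<subseteq> {1..m}" using PQ by auto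
  obtain \<delta> where \<delta>: "\<delta> \<noteq> 0" "s p \<noteq> \<delta>" "\<And>k. k \<in> Q \<Longrightarrow> s k = s p + \<delta>"
  proof (cases "Q = {}")
    case True
    obtain \<delta> where "\<delta> \<noteq> 0" "\<delta> \<noteq> s p" by (rule klein_other)
    then show ?thesis using True by (intro that[of \<delta>]) auto
  next
    case False
    then obtain l where l: "l \<in> Q" by blast
    show ?thesis
    proof (rule that[of "s p + s l"])
      show "s p + s l \<noteq> 0" using differ[OF s p(1) l] by (simp add: klein_add_eq_0_iff)
      show "s p \<noteq> s p + s l" using nonzero[OF s, of l] l sub by auto
      show "s k = s p + (s p + s l)" if "k \<in> Q" for k using constQ[OF s that l] by simp
    qed
  qed
  obtain q t where q: "q \<in> {1..m}" "q \<noteq> p" "s q \<noteq> \<delta>" and t: "t \<in> S" "switched m p q \<delta> s t"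
    using kempe_closedE[OF closed s _ \<delta>(1,2)] p sub by blast
  have tk: "t k = (if k = p \<or> k = q then s k + \<delta> else s k)" if "k \<in> {1..m}" for k
    using t that by (auto simp: switched_def)
  have pm: "p \<in> {1..m}" "p \<noteq> i" "p \<noteq> j" using p ij sub by auto
  have "q \<noteq> i" "q \<noteq> j"
    using tk[OF ij(1)] tk[OF ij(2)] equal[OF s] equal[OF t(1)] ij pm \<delta> by auto
  then consider "q \<in> P" | "q \<in> Q" using q(1) PQ(1) by blast
  then show False
  proof cases
    case 1
    have tp: "t p = s p + \<delta>" using tk[of p] pm by simp
    have "P \<subseteq> {p, q}"
    proof
      fix k assume k: "k \<in> P"
      have "t k \<noteq> s k" using constP[OF t(1) k p(1)] constP[OF s k p(1)] tp \<delta> by simp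
      then show "k \<in> {p, q}" using tk[of k] k sub by (auto split: if_splits)
    qed
    then have "card P \<le> 2" using card_mono[of "{p, q}" P] card_insert_le_m1[of 2 "{q}" p] by simp
    then have "Q \<noteq> {}" using big by auto
    then obtain l where l: "l \<in> Q" by blast
    then have "l \<noteq> p" "l \<noteq> q" using 1 p PQ by auto
    then have "t l = t p" using tk[of l] l sub tp \<delta>(3)[OF l] by auto
    then show False using differ[OF t(1) p(1) l] by simp
  next
    case 2
    then have "p' \<noteq> q" using p PQ by auto
    then have "t p' = s p'" using tk[of p'] p sub by auto
    then show False using tk[of p] pm constP[OF s p(1,2)] constP[OF t(1) p(1,2)] \<delta> by simp
  qed
qed

end

sublocale equal_pair \<subseteq> opposite: equal_pair m S i j Q P
proof
  show "s k \<noteq> s l" if "s \<in> S" "k \<in> Q" "l \<in> P" for s k l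
    using differ that by metis
qed (use closed ij PQ nonzero equal constP constQ in \<open>auto\<close>)

lemma (in equal_pair) contradiction:
  assumes "s \<in> S" and big: "card P + card Q \<ge> 3"
  shows False
proof -
  have "finite P" "finite Q" using PQ(1) by (metis finite_Un finite_atLeastAtMost)+
  moreover have "card P \<ge> 2 \<or> card Q \<ge> 2" using big by linarith
  ultimately have "(\<exists>p\<in>P. \<exists>p'\<in>P. p \<noteq> p') \<or> (\<exists>p\<in>Q. \<exists>p'\<in>Q. p \<noteq> p')"
    by (metis One_nat_def card_le_Suc0_iff_eq not_less_eq_eq numeral_2_eq_2)
  then show False
    using long_arc_False opposite.long_arc_False assms by (metis add.commute)
qed

section \<open>The circle cut at two semiedges\<close>

locale cyclic_pair =
  fixes m :: nat and S :: "(nat \<Rightarrow> klein) set" and i j :: nat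
  assumes closed: "kempe_closed m S" and cyclic: "s \<in> S \<Longrightarrow> cyclic_state m s"
    and ij: "1 \<le> i" "i < j" "j \<le> m"
begin

text \<open>\<open>W s k\<close> belongs to the gap after position \<open>k\<close>, so an arc has
  one more gap than positions. The gap between \<open>m\<close> and 1 occurs under both indices 0
  and \<open>m\<close>.\<close>

abbreviation W :: "(nat \<Rightarrow> klein) \<Rightarrow> nat \<Rightarrow> klein" where "W s k \<equiv> sum s {1..k}"
abbreviation P :: "nat set" where "P \<equiv> {i<..<j}"
abbreviation Q :: "nat set" where "Q \<equiv> {1..<i} \<union> {j<..m}"
abbreviation WP :: "(nat \<Rightarrow> klein) \<Rightarrow> klein set" where "WP s \<equiv> W s ` {i..<j}"
abbreviation WQ :: "(nat \<Rightarrow> klein) \<Rightarrow> klein set" where "WQ s \<equiv> W s ` ({0..<i} \<union> {j..m})"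

lemma nonzero: "s \<in> S \<Longrightarrow> k \<in> {1..m} \<Longrightarrow> s k \<noteq> 0"
  using cyclic by (auto simp: cyclic_state_def)

lemma W_step: "1 \<le> k \<Longrightarrow> W s k = W s (k - 1) + s k"
  by (cases k) (auto simp: add.commute)

lemma W_before: "W s (i - 1) \<in> WQ s" "W s (i - 1) + s i \<in> WP s"
  using ij W_step[of i s, symmetric] by auto

lemma W_after: "W s (j - 1) \<in> WP s" "W s (j - 1) + s j \<in> WQ s"
  using ij W_step[of j s, symmetric] by auto

lemma W_inside: "k \<in> P \<Longrightarrow> W s (k - 1) \<in> WP s \<and> W s (k - 1) + s k \<in> WP s"
  using W_step[of k s, symmetric] ij by (auto intro!: imageI)

lemma W_outside: "k \<in> Q \<Longrightarrow> W s (k - 1) \<in> WQ s \<and> W s (k - 1) + s k \<in> WQ s"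
  using W_step[of k s, symmetric] ij by (auto intro!: imageI)

lemma missed:
  assumes "t \<in> S" "switched m i j \<delta> s t"
  shows "\<exists>z. z \<notin> WQ s \<and> z + \<delta> \<notin> WP s"
  using missed_point_switched[OF cyclic[OF assms(1)] assms(2) ij] .

lemma missed_self: "s \<in> S \<Longrightarrow> \<exists>z. z \<notin> WQ s \<and> z \<notin> WP s"
  \<comment> \<open>With \<open>\<delta> = 0\<close> every state is a switch of itself.\<close>
  using missed[of s 0 s] by (simp add: switched_def)

lemma arcs: "P \<union> Q \<union> {i, j} = {1..m}" "P \<inter> Q = {}" "i \<notin> P \<union> Q" "j \<notin> P \<union> Q"
  using ij by auto

lemma card_arcs: "card P + card Q + 2 = m"
proof -
  have "card ((P \<union> Q) \<union> {i, j}) = card (P \<union> Q) + card {i, j}"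
    by (rule card_Un_disjoint) (use arcs in auto)
  also have "card (P \<union> Q) = card P + card Q"
    by (rule card_Un_disjoint) (use arcs in auto)
  finally have "card {1..m} = card P + card Q + card {i, j}" by (simp only: arcs(1))
  then show ?thesis using ij by simp
qed

lemma equal_False:
  assumes eq: "\<And>s. s \<in> S \<Longrightarrow> s i = s j" and "m \<ge> 5" "S \<noteq> {}"
  shows False
proof -
  have miss: "\<exists>z. z \<notin> WQ s \<and> z + \<delta> \<notin> WP s" if s: "s \<in> S" and \<delta>: "\<delta> \<noteq> s i" for s \<delta>
  proof (cases "\<delta> = 0")
    case True
    then show ?thesis using missed_self[OF s] by simp
  next
    case False
    then obtain q t where q: "q \<in> {1..m}" "q \<noteq> i" and t: "t \<in> S" "switched m i q \<delta> s t"
      using kempe_closedE[OF closed s, of i \<delta>] ij \<delta> by (metis atLeastAtMost_iff less_imp_le order_trans)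
    \<comment> \<open>Any other end would change the colour at \<open>i\<close> but not at
      \<open>j\<close>.\<close>
    have "q = j"
    proof (rule ccontr)
      assume "q \<noteq> j"
      then have "t i = s i + \<delta>" "t j = s j" using t ij by (auto simp: switched_def)
      then show False using eq[OF s] eq[OF t(1)] False by simp
    qed
    then show ?thesis using missed t by blast
  qed
  interpret equal_pair m S i j P Q
  proof
    fix s k l assume s: "s \<in> S"
    have u: "s i \<noteq> 0" using nonzero[OF s] ij by simp
    have missP: "\<exists>z. z \<notin> WQ s \<and> z + \<delta> \<notin> WP s" if "\<delta> \<noteq> s i" for \<delta>
      using miss s that by blast
    have missQ: "\<exists>z. z \<notin> WP s \<and> z + \<delta> \<notin> WQ s" if \<delta>: "\<delta> \<noteq> s i" for \<delta>
    proof -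
      obtain z where "z \<notin> WQ s" "z + \<delta> \<notin> WP s" using missP[OF \<delta>] by blast
      then show ?thesis by (intro exI[of _ "z + \<delta>"]) (simp add: add.assoc)
    qed
    note PP = klein_equal_arcs[OF missP u W_before]
    note QQ = klein_equal_arcs[OF missQ u W_before(2)]
    \<comment> \<open>Each \<open>s k\<close> is the difference of the partial sums before and after
      \<open>k\<close>, which lie on the same arc; this turns statements about differences into
      statements about colours.\<close>
    show "s k = s l" if kl: "k \<in> P" "l \<in> P"
      using PP(1)[of "W s (k - 1)" "s k" "W s (l - 1)" "s l"] W_inside[of k s] W_inside[of l s]
        nonzero[OF s, of k] nonzero[OF s, of l] kl ij by auto
    show "s k \<noteq> s l" if kl: "k \<in> P" "l \<in> Q"
      using PP(2)[of "W s (k - 1)" "s k" "W s (l - 1)"] W_inside[of k s] W_outside[of l s]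
        nonzero[OF s, of k] nonzero[OF s, of l] kl ij by auto
    show "s k = s l" if kl: "k \<in> Q" "l \<in> Q"
    proof (rule QQ(1))
      show "W s (i - 1) + s i + s i \<in> WQ s" using W_before(1)[of s] by (simp add: add.assoc)
      show "s k \<noteq> 0" "s l \<noteq> 0" using nonzero[OF s] kl ij by auto
    qed (use W_outside[OF kl(1)] W_outside[OF kl(2)] in blast)+
  qed (use closed ij nonzero eq arcs in auto)
  show False using contradiction card_arcs assms by fastforce
qed

lemma distinct_False:
  assumes ne: "\<And>s. s \<in> S \<Longrightarrow> s i \<noteq> s j" and "m \<ge> 5" "S \<noteq> {}"
  shows False
proof -
  have miss: "\<exists>z. z \<notin> WQ s \<and> z + (s i + s j) \<notin> WP s" if s: "s \<in> S" for s
  proof -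
    have "s i + s j \<noteq> 0" using ne[OF s] by (simp add: klein_add_eq_0_iff)
    moreover have "s i \<noteq> s i + s j" using nonzero[OF s, of j] ij by simp
    ultimately obtain q t where q: "q \<in> {1..m}" "q \<noteq> i" and t: "t \<in> S" "switched m i q (s i + s j) s t"
      using kempe_closedE[OF closed s, of i "s i + s j"] ij by (metis atLeastAtMost_iff less_imp_le order_trans)
    \<comment> \<open>Adding \<open>s i + s j\<close> at \<open>i\<close> alone would give
      \<open>i\<close> the colour of \<open>j\<close>.\<close>
    have "q = j"
    proof (rule ccontr)
      assume "q \<noteq> j"
      then have "t i = t j" using t ij by (auto simp: switched_def)
      then show False using ne[OF t(1)] by simp
    qed
    then show ?thesis using missed t by blast
  qed
  have split: "sum s {1..m} = sum s P + sum s Q + (s i + s j)" for s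
  proof -
    have "sum s ((P \<union> Q) \<union> {i, j}) = sum s (P \<union> Q) + sum s {i, j}"
      by (rule sum.union_disjoint) (use arcs in auto)
    also have "sum s (P \<union> Q) = sum s P + sum s Q"
      by (rule sum.union_disjoint) (use arcs in auto)
    finally have "sum s {1..m} = sum s P + sum s Q + sum s {i, j}" by (simp only: arcs(1))
    then show ?thesis using ij by simp
  qed
  have total: "sum s P + sum s Q = s i + s j" if "s \<in> S" for s
    using split[of s] cyclic[OF that] by (simp add: cyclic_state_def klein_add_eq_0_iff)
  \<comment> \<open>The right-hand sides of \<open>sumP\<close> and \<open>sumQ\<close> have the
    form \<open>x + a + y\<close> of \<open>klein_distinct_arcs\<close>, applied to the arcs in
    either order.\<close>
  have sumP: "sum s P = W s (i - 1) + s i + W s (j - 1)" for s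
  proof -
    have "{1..j - 1} = {1..i} \<union> P" using ij by auto
    moreover have "sum s ({1..i} \<union> P) = W s i + sum s P"
      by (rule sum.union_disjoint) auto
    ultimately have "W s (j - 1) = W s i + sum s P" by (simp only:)
    then show ?thesis using W_step[of i s] ij by simp
  qed
  have sumQ: "sum s Q = (W s (i - 1) + s i) + s i + (W s (j - 1) + s j)" if "s \<in> S" for s
  proof -
    have "sum s Q = sum s P + (s i + s j)"
      using total[OF that] by (metis klein_add_left_self)
    then show ?thesis unfolding sumP by (simp add: ac_simps)
  qed
  \<comment> \<open>The outer arc wraps around: its position next to \<open>j\<close> is
    \<open>j + 1\<close> if \<open>j < m\<close>; otherwise its position next to \<open>i\<close> is
    taken.\<close>
  define g where "g = (if j < m then j + 1 else i - 1)"
  interpret distinct_pair m S i j P Q "i + 1" g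
  proof
    fix s k assume s: "s \<in> S"
    have nz: "s i \<noteq> 0" "s j \<noteq> 0" "s i \<noteq> s j" using nonzero[OF s] ne[OF s] ij by auto
    obtain z0 where z0: "z0 \<notin> WP s" "z0 \<notin> WQ s" using missed_self[OF s] by blast
    obtain z1 where z1: "z1 \<notin> WQ s" "z1 + (s i + s j) \<notin> WP s" using miss[OF s] by blast
    note PP = klein_distinct_arcs[OF nz z0 z1 W_before W_after]
    have z1': "z1 + (s i + s j) + (s i + s j) \<notin> WQ s" using z1 by (simp add: add.assoc)
    have before: "W s (i - 1) + s i + s i \<in> WQ s" using W_before(1)[of s] by (simp add: add.assoc)
    have after: "W s (j - 1) + s j + s j \<in> WP s" using W_after(1)[of s] by (simp add: add.assoc)
    note QQ = klein_distinct_arcs[OF nz z0(2,1) z1(2) z1' W_before(2) before W_after(2) after]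
    show "s k = sum s P" if "sum s P \<noteq> 0" "k \<in> P"
      unfolding sumP by (rule PP(1)[of "W s (k - 1)"])
        (use that W_inside[of k s] nonzero[OF s, of k] ij in \<open>auto simp: sumP\<close>)
    show "s k = sum s Q" if "sum s Q \<noteq> 0" "k \<in> Q"
      unfolding sumQ[OF s] by (rule QQ(1)[of "W s (k - 1)"])
        (use that W_outside[of k s] nonzero[OF s, of k] ij in \<open>simp_all only: sumQ[OF s], auto\<close>)
    show "s (i + 1) \<noteq> s i + s j" if "P \<noteq> {}" "sum s P = 0"
    proof
      \<comment> \<open>This colour would lead to the partial sum \<open>W s (i - 1) + s j\<close>,
        which the second part of \<open>klein_distinct_arcs\<close> excludes from
        \<open>WP s\<close>.\<close>
      assume eq: "s (i + 1) = s i + s j"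
      have "i + 1 \<in> P" using that ij by auto
      then have "W s i + s (i + 1) \<in> WP s" using W_inside[of "i + 1" s] by simp
      moreover have "W s i + s (i + 1) = W s (i - 1) + s j"
        using W_step[of i s] ij unfolding eq by (simp add: add.assoc)
      ultimately show False using PP(2) that by (simp add: sumP klein_add_eq_0_iff)
    qed
    show "s g \<noteq> s i + s j" if Q: "Q \<noteq> {}" and "sum s Q = 0"
    proof
      assume eq: "s g = s i + s j"
      have notin: "W s (i - 1) + s i + s j \<notin> WQ s"
        using QQ(2) that(2) unfolding sumQ[OF s] by (simp add: klein_add_eq_0_iff)
      show False
      proof (cases "j < m")
        case True
        then have "W s j + s g \<in> WQ s" using W_outside[of g s] by (simp add: g_def)
        \<comment> \<open>As \<open>Q\<close> has sum 0, the partial sums at the two ends of the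
          outer arc coincide.\<close>
        moreover have "W s j = W s (i - 1)"
          using that(2) W_step[of j s] ij unfolding sumQ[OF s] by (simp add: klein_add_eq_0_iff add.assoc)
        ultimately show False using notin eq by (simp add: add.assoc)
      next
        case False
        then have i: "1 < i" using Q ij by force
        have "W s (i - 1) = W s (i - 1 - 1) + s (i - 1)" using W_step[of "i - 1" s] i by simp
        then have "W s (i - 1 - 1) = W s (i - 1) + s g"
          using False by (simp add: g_def add.assoc)
        moreover have "W s (i - 1 - 1) \<in> WQ s" using i by auto
        ultimately show False using notin eq by (simp add: add.assoc)
      qed
    qed
  qed (use closed ij nonzero ne arcs total in \<open>auto simp: g_def\<close>)
  show False using contradiction card_arcs assms by fastforce
qed

end

section \<open>Kempe chains in multipoles\<close>

abbreviation links :: "nat \<Rightarrow> multipole \<Rightarrow> link set" where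
  "links m M \<equiv> Edge ` edges M \<union> Semi ` {1..m}"

locale colored_pole =
  fixes m :: nat and M :: multipole and \<phi> :: "link \<Rightarrow> nat"
  assumes pole: "m_pole m M" and coloring: "tait_coloring m M \<phi>"
begin

lemma color_range: "x \<in> links m M \<Longrightarrow> \<phi> x \<in> {1, 2, 3}"
  using coloring unfolding tait_coloring_def by blast

lemma inj_incident: "v \<in> verts M \<Longrightarrow> inj_on \<phi> (incident m M v)"
  using coloring unfolding tait_coloring_def by blast

lemma incident_links: "incident m M v \<subseteq> links m M"
  unfolding incident_def by auto

lemma finite_links: "finite (links m M)"
  using pole by (simp add: m_pole_def)

text \<open>A coloring excludes loops, so the degree condition counts three different links, and
  their colours are distinct.\<close>

lemma colors_at_vertex:
  assumes v: "v \<in> verts M"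
  shows "\<phi> ` incident m M v = {1, 2, 3}"
proof -
  let ?E = "{e \<in> edges M. v \<in># ends M e}" and ?I = "{i \<in> {1..m}. attach M i = Vertex v}"
  have fin: "finite (edges M)" using pole by (simp add: m_pole_def)
  have "count (ends M e) v = (if v \<in># ends M e then 1 else 0)" if "e \<in> edges M" for e
  proof -
    have "count (ends M e) v \<le> 1" using coloring v that unfolding tait_coloring_def by blast
    then show ?thesis by (metis count_eq_zero_iff le_antisym not_less_eq_eq One_nat_def le_0_eq)
  qed
  then have "(\<Sum>e\<in>edges M. count (ends M e) v) = (\<Sum>e\<in>edges M. if v \<in># ends M e then 1 else 0)"
    by simp
  also have "\<dots> = card ?E" using fin by (simp flip: sum.inter_filter)
  finally have "card ?E + card ?I = 3"
    using pole v unfolding m_pole_def by metis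
  moreover have "card (incident m M v) = card (Edge ` ?E) + card (Semi ` ?I)"
    unfolding incident_def by (rule card_Un_disjoint) (use fin in auto)
  moreover have "card (Edge ` ?E) = card ?E" "card (Semi ` ?I) = card ?I"
    by (auto intro!: card_image inj_onI)
  ultimately have "card (\<phi> ` incident m M v) = 3"
    using card_image[OF inj_incident[OF v]] by simp
  then show ?thesis
    using color_range incident_links by (intro card_subset_eq) (simp_all, blast)
qed

text \<open>Since exactly two links at a vertex avoid \<open>\<delta>\<close>, a Kempe chain passes
  through the vertex in only one way.\<close>

lemma other_link:
  assumes v: "v \<in> verts M" and x: "x \<in> incident m M v" "\<phi> x \<noteq> \<delta>" and \<delta>: "\<delta> \<in> {1, 2, 3}"
  obtains y where "y \<in> incident m M v" "\<phi> y \<noteq> \<delta>" "y \<noteq> x"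
    "\<And>z. z \<in> incident m M v \<Longrightarrow> \<phi> z \<noteq> \<delta> \<Longrightarrow> z = x \<or> z = y"
proof -
  \<comment> \<open>As \<open>1 + 2 + 3 = 6\<close>, the third colour is \<open>6 - \<delta> - \<phi> x\<close>.\<close>
  have \<phi>x: "\<phi> x \<in> {1, 2, 3}" using x incident_links color_range by blast
  then have "6 - \<delta> - \<phi> x \<in> {1, 2, 3}" using x \<delta> by auto
  then obtain y where y: "y \<in> incident m M v" "\<phi> y = 6 - \<delta> - \<phi> x"
    using colors_at_vertex[OF v] by (metis imageE)
  show ?thesis
  proof
    show "z = x \<or> z = y" if z: "z \<in> incident m M v" "\<phi> z \<noteq> \<delta>" for z
    proof -
      have "\<phi> z \<in> {1, 2, 3}" using z incident_links color_range by blast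
      then have "\<phi> z = \<phi> x \<or> \<phi> z = \<phi> y" using \<phi>x y x \<delta> z by auto
      then show ?thesis using inj_incident[OF v] x y z by (metis inj_onD)
    qed
  qed (use y \<phi>x x \<delta> in auto)
qed

lemma edge_ends:
  assumes "Edge e \<in> incident m M h"
  obtains h' where "h' \<in> verts M" "h' \<noteq> h" "Edge e \<in> incident m M h'"
    "\<And>v. Edge e \<in> incident m M v \<Longrightarrow> v = h \<or> v = h'"
proof -
  have e: "e \<in> edges M" "h \<in># ends M e" using assms by (auto simp: incident_def)
  then have 2: "size (ends M e) = 2" and sub: "set_mset (ends M e) \<subseteq> verts M"
    using pole by (auto simp: m_pole_def)
  obtain N where N: "ends M e = add_mset h N" using e by (metis mset_add)
  then have "size N = 1" using 2 by simp
  then obtain h' where h': "ends M e = {#h, h'#}" using N size_1_singleton_mset by auto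
  have "count (ends M e) h \<le> 1"
    using coloring e sub unfolding tait_coloring_def by blast
  then have "h' \<noteq> h" using h' by auto
  then show ?thesis using e sub h' by (intro that[of h']) (auto simp: incident_def)
qed

definition closed_at :: "nat \<Rightarrow> link set \<Rightarrow> nat \<Rightarrow> bool" where
  "closed_at \<delta> X v \<longleftrightarrow>
     (\<forall>x\<in>X \<inter> incident m M v. \<forall>y\<in>incident m M v. \<phi> y \<noteq> \<delta> \<longrightarrow> y \<in> X)"

text \<open>The chain is encoded by closure conditions on a set of links instead of an ordering
  along a path, because closure is what makes switching preserve a coloring.\<close>

definition kempe_chain :: "nat \<Rightarrow> link set \<Rightarrow> nat \<Rightarrow> nat \<Rightarrow> bool" where
  "kempe_chain \<delta> X p q \<longleftrightarrow>
     X \<subseteq> links m M \<and> (\<forall>x\<in>X. \<phi> x \<noteq> \<delta>) \<and> (\<forall>v\<in>verts M. closed_at \<delta> X v) \<and>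
     (\<forall>k\<in>{1..m}. \<forall>l. attach M k = Semiedge l \<longrightarrow> Semi k \<in> X \<longrightarrow> Semi l \<in> X) \<and>
     (\<forall>k. Semi k \<in> X \<longleftrightarrow> k = p \<or> k = q)"

lemma kempe_chainD:
  assumes "kempe_chain \<delta> X p q"
  shows "x \<in> X \<Longrightarrow> x \<in> links m M" and "x \<in> X \<Longrightarrow> \<phi> x \<noteq> \<delta>"
    and "v \<in> verts M \<Longrightarrow> closed_at \<delta> X v"
    and "k \<in> {1..m} \<Longrightarrow> attach M k = Semiedge l \<Longrightarrow> Semi k \<in> X \<Longrightarrow> Semi l \<in> X"
    and "Semi k \<in> X \<longleftrightarrow> k = p \<or> k = q"
  using assms unfolding kempe_chain_def by (elim conjE; blast)+

text \<open>
  \<open>X\<close> is the part of the chain traversed from \<open>p\<close> so far.  It enters \<open>h\<close> through \<open>x\<close> and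
  continues through \<open>y\<close>; every vertex other than \<open>h\<close> meets it in none or both of its links not
  coloured \<open>\<delta>\<close>, so the path cannot run into itself.
\<close>
lemma extend_kempe_chain:
  assumes \<delta>: "\<delta> \<in> {1, 2, 3}" and p: "attach M p = Vertex w"
    and "X \<subseteq> links m M" "\<forall>x\<in>X. \<phi> x \<noteq> \<delta>" "\<forall>k. Semi k \<in> X \<longleftrightarrow> k = p"
    and "h \<in> verts M" "x \<in> X" "x \<in> incident m M h" "y \<in> incident m M h" "\<phi> y \<noteq> \<delta>" "y \<notin> X"
    and "\<forall>v\<in>verts M - {h}. closed_at \<delta> X v"
  shows "\<exists>Y q. q \<noteq> p \<and> kempe_chain \<delta> Y p q"
  using assms(3-)
proof (induction "card (links m M - X)" arbitrary: X h x y rule: less_induct)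
  case less
  have x: "\<phi> x \<noteq> \<delta>" "x \<noteq> y" using less.prems by auto
  obtain y0 where y0: "\<And>z. z \<in> incident m M h \<Longrightarrow> \<phi> z \<noteq> \<delta> \<Longrightarrow> z = x \<or> z = y0"
    using other_link[OF \<open>h \<in> verts M\<close> \<open>x \<in> incident m M h\<close> x(1) \<delta>] by blast
  have two: "z = x \<or> z = y" if "z \<in> incident m M h" "\<phi> z \<noteq> \<delta>" for z
    using y0[OF that] y0[OF less.prems(7,8)] x(2) by blast
  have y: "y \<in> links m M" using less.prems incident_links by blast
  have h: "closed_at \<delta> (insert y X) h"
    unfolding closed_at_def using two \<open>x \<in> X\<close> by blast
  have other: "closed_at \<delta> (insert y X) v"
    if "v \<in> verts M" "v \<noteq> h" "y \<notin> incident m M v" for v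
  proof -
    have "closed_at \<delta> X v" using less.prems(10) that by blast
    then show ?thesis unfolding closed_at_def using that(3) by blast
  qed
  show ?case
  proof (cases y)
    case (Semi q)
    have q: "attach M q = Vertex h" using less.prems(7) Semi by (auto simp: incident_def)
    have "closed_at \<delta> (insert y X) v" if "v \<in> verts M" for v
    proof (cases "v = h")
      case False
      then have "y \<notin> incident m M v" using q Semi by (auto simp: incident_def)
      then show ?thesis using other that False by blast
    qed (use h in simp)
    moreover have "q \<noteq> p" using less.prems Semi by auto
    moreover have semis: "Semi k \<in> insert y X \<longleftrightarrow> k = p \<or> k = q" for k
      using less.prems(3) Semi by auto
    \<comment> \<open>Both ends are attached to vertices, so the clause about free edges holds
      vacuously.\<close>
    moreover have "attach M k \<noteq> Semiedge l" if "Semi k \<in> insert y X" for k l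
      using that p q unfolding semis by auto
    moreover have "insert y X \<subseteq> links m M" using less.prems(1) y by blast
    moreover have "\<phi> z \<noteq> \<delta>" if "z \<in> insert y X" for z using less.prems(2,8) that by blast
    ultimately have "kempe_chain \<delta> (insert y X) p q"
      unfolding kempe_chain_def by blast
    then show ?thesis using \<open>q \<noteq> p\<close> by blast
  next
    case (Edge e)
    obtain h' where h': "h' \<in> verts M" "h' \<noteq> h" "y \<in> incident m M h'"
      and only: "\<And>v. y \<in> incident m M v \<Longrightarrow> v = h \<or> v = h'"
      using edge_ends[OF less.prems(7)[unfolded Edge]] unfolding Edge by blast
    obtain y' where y': "y' \<in> incident m M h'" "\<phi> y' \<noteq> \<delta>" "y' \<noteq> y"
      using other_link[OF h'(1,3) less.prems(8) \<delta>] by blast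
    \<comment> \<open>\<open>X\<close> is closed at \<open>h'\<close> but lacks \<open>y\<close>, so
      it contains no link there that avoids \<open>\<delta>\<close>; the next link is therefore
      new.\<close>
    have "closed_at \<delta> X h'" using less.prems h' by blast
    then have "y' \<notin> X"
      using y'(1) h'(3) less.prems(8,9) unfolding closed_at_def by blast
    show ?thesis
    proof (rule less.hyps[of "insert y X" h' y y'])
      have "links m M - insert y X \<subset> links m M - X" using y less.prems(9) by blast
      then show "card (links m M - insert y X) < card (links m M - X)"
        using finite_links by (intro psubset_card_mono) simp_all
      show "\<forall>v\<in>verts M - {h'}. closed_at \<delta> (insert y X) v"
        using h other only by blast
      show "insert y X \<subseteq> links m M" using less.prems(1) y by blast
      show "\<forall>z\<in>insert y X. \<phi> z \<noteq> \<delta>" using less.prems(2,8) by blast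
      show "\<forall>k. Semi k \<in> insert y X \<longleftrightarrow> k = p" using less.prems(3) Edge by blast
      show "y' \<notin> insert y X" using y'(3) \<open>y' \<notin> X\<close> by blast
    qed (use y' h' in simp_all)
  qed
qed

lemma ex_kempe_chain:
  assumes \<delta>: "\<delta> \<in> {1, 2, 3}" and p: "p \<in> {1..m}" "\<phi> (Semi p) \<noteq> \<delta>"
  obtains X q where "q \<noteq> p" "kempe_chain \<delta> X p q"
proof (cases "attach M p")
  case (Vertex w)
  have w: "w \<in> verts M" using pole p Vertex unfolding m_pole_def by fastforce
  have pw: "Semi p \<in> incident m M w" using p Vertex by (auto simp: incident_def)
  obtain y where y: "y \<in> incident m M w" "\<phi> y \<noteq> \<delta>" "y \<noteq> Semi p"
    using other_link[OF w pw p(2) \<delta>] by metis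
  have "\<exists>Y q. q \<noteq> p \<and> kempe_chain \<delta> Y p q"
    by (rule extend_kempe_chain[OF \<delta> Vertex, of "{Semi p}" w "Semi p" y])
      (use p w pw y Vertex in \<open>auto simp: closed_at_def incident_def\<close>)
  then show ?thesis using that by blast
next
  case (Semiedge q)
  then have q: "q \<in> {1..m}" "q \<noteq> p" "attach M q = Semiedge p"
    using pole p unfolding m_pole_def by fastforce+
  moreover have "\<phi> (Semi q) = \<phi> (Semi p)"
    using coloring Semiedge p q unfolding tait_coloring_def by metis
  \<comment> \<open>A free edge is a complete chain, as its semiedges meet no vertex.\<close>
  ultimately have "kempe_chain \<delta> {Semi p, Semi q} p q"
    using p Semiedge by (auto simp: kempe_chain_def closed_at_def incident_def)
  with q show ?thesis using that by blast
qed

text \<open>As 1 + 2 + 3 = 6, subtraction from \<open>6 - \<delta>\<close> exchanges the two colours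
  other than \<open>\<delta>\<close>. At each vertex \<open>X\<close> contains both or neither of
  the links so coloured, hence colours stay distinct.\<close>

lemma tait_coloring_switch:
  assumes \<delta>: "\<delta> \<in> {1, 2, 3}" and X: "kempe_chain \<delta> X p q"
  shows "tait_coloring m M (\<lambda>x. if x \<in> X then 6 - \<delta> - \<phi> x else \<phi> x)" (is "tait_coloring m M ?\<psi>")
proof -
  have sw: "6 - \<delta> - \<phi> x \<in> {1, 2, 3} \<and> 6 - \<delta> - \<phi> x \<noteq> \<delta> \<and> \<phi> x = 6 - \<delta> - (6 - \<delta> - \<phi> x)"
    if "x \<in> X" for x
  proof -
    have x: "x \<in> links m M" "\<phi> x \<noteq> \<delta>" using kempe_chainD(1,2)[OF X that] .
    from x(1) have "\<phi> x \<in> {1, 2, 3}" by (rule color_range)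
    then show ?thesis using \<delta> x(2) by auto
  qed
  have inj: "inj_on ?\<psi> (incident m M v)" if v: "v \<in> verts M" for v
  proof (rule inj_onI)
    fix x y assume xy: "x \<in> incident m M v" "y \<in> incident m M v" "?\<psi> x = ?\<psi> y"
    have cl: "b \<in> X" if "a \<in> X" "a \<in> incident m M v" "b \<in> incident m M v" "\<phi> b \<noteq> \<delta>" for a b
      using kempe_chainD(3)[OF X v] that unfolding closed_at_def by blast
    have "\<phi> x = \<phi> y"
    proof (cases "x \<in> X"; cases "y \<in> X")
      assume "x \<in> X" "y \<in> X"
      then show ?thesis using xy(3) sw[of x] sw[of y] by simp
    next
      assume "x \<in> X" "y \<notin> X"
      then show ?thesis using xy sw[of x] cl[of x y] by auto
    next
      assume "x \<notin> X" "y \<in> X"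
      then show ?thesis using xy sw[of y] cl[of y x] by auto
    qed (use xy in simp)
    then show "x = y" using inj_incident[OF v] xy by (meson inj_onD)
  qed
  have free: "\<phi> (Semi k) = \<phi> (Semi l) \<and> (Semi k \<in> X \<longleftrightarrow> Semi l \<in> X)"
    if "k \<in> {1..m}" "l \<in> {1..m}" "attach M k = Semiedge l" for k l
  proof -
    have "attach M l = Semiedge k" using pole that unfolding m_pole_def by fastforce
    moreover have "\<phi> (Semi k) = \<phi> (Semi l)"
      using coloring that unfolding tait_coloring_def by blast
    ultimately show ?thesis using kempe_chainD(4)[OF X] that by blast
  qed
  have range: "?\<psi> x \<in> {1, 2, 3}" if "x \<in> links m M" for x
    using sw[of x] color_range[OF that] by (cases "x \<in> X") (simp_all only: if_True if_False)
  have loopless: "\<forall>v\<in>verts M. \<forall>e\<in>edges M. count (ends M e) v \<le> 1"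
    using coloring unfolding tait_coloring_def by blast
  show ?thesis
    unfolding tait_coloring_def
  proof (intro conjI ballI impI)
    show "?\<psi> x \<in> {1, 2, 3}" if "x \<in> links m M" for x using range[OF that] .
    show "count (ends M e) v \<le> 1" if "v \<in> verts M" "e \<in> edges M" for v e using loopless that by blast
    show "inj_on ?\<psi> (incident m M v)" if "v \<in> verts M" for v using inj[OF that] .
    show "?\<psi> (Semi k) = ?\<psi> (Semi l)"
      if "k \<in> {1..m}" "l \<in> {1..m}" "attach M k = Semiedge l" for k l
      using free[OF that] by simp
  qed
qed

end

section \<open>Colours as nonzero group elements\<close>

text \<open>For a colour \<open>n\<close> these are its two binary digits, so addition is bitwise
  exclusive or.\<close>

definition klein_of :: "nat \<Rightarrow> klein" where
  "klein_of n = (of_bool (odd n), of_bool (2 \<le> n))"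

lemma klein_of_simps [simp]:
  "klein_of (Suc 0) = (1, 0)" "klein_of 2 = (0, 1)" "klein_of 3 = (1, 1)"
  by (simp_all add: klein_of_def)

lemma klein_of_nonzero: "x \<in> {1, 2, 3} \<Longrightarrow> klein_of x \<noteq> 0"
  by (auto simp: zero_prod_def)

lemma klein_of_inj: "x \<in> {1, 2, 3} \<Longrightarrow> y \<in> {1, 2, 3} \<Longrightarrow> klein_of x = klein_of y \<longleftrightarrow> x = y"
  by auto

lemma klein_of_third:
  "x \<in> {1, 2, 3} \<Longrightarrow> y \<in> {1, 2, 3} \<Longrightarrow> z \<in> {1, 2, 3} \<Longrightarrow> x \<noteq> y \<Longrightarrow> x \<noteq> z \<Longrightarrow> y \<noteq> z \<Longrightarrow>
    klein_of z = klein_of x + klein_of y"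
  by auto

lemma klein_of_surj:
  assumes "\<delta> \<noteq> 0" obtains d where "d \<in> {1, 2, 3}" "\<delta> = klein_of d"
proof -
  obtain a b where "\<delta> = (a, b)" by fastforce
  with assms have "\<delta> \<in> {klein_of 1, klein_of 2, klein_of 3}"
    by (cases a; cases b) (auto simp: zero_prod_def)
  then show ?thesis using that by blast
qed

text \<open>Values at indices outside \<open>{1..m}\<close> are arbitrary; \<open>switched\<close>
  and \<open>cyclic_state\<close> look only inside this range.\<close>

definition states :: "nat \<Rightarrow> multipole \<Rightarrow> (nat \<Rightarrow> klein) set" where
  "states m M = {\<lambda>k. klein_of (\<phi> (Semi k)) |\<phi>. tait_coloring m M \<phi>}"

lemma statesE:
  assumes "s \<in> states m M"
  obtains \<phi> where "tait_coloring m M \<phi>" "\<And>k. s k = klein_of (\<phi> (Semi k))"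
proof -
  obtain \<phi> where "tait_coloring m M \<phi>" "s = (\<lambda>k. klein_of (\<phi> (Semi k)))"
    using assms unfolding states_def by blast
  then show ?thesis by (intro that[of \<phi>]) simp_all
qed

lemma kempe_closed_states:
  assumes pole: "m_pole m M"
  shows "kempe_closed m (states m M)"
  unfolding kempe_closed_def
proof (intro ballI allI impI)
  fix s p and \<delta> :: klein
  assume s: "s \<in> states m M" and p: "p \<in> {1..m}" and \<delta>: "\<delta> \<noteq> 0" "s p \<noteq> \<delta>"
  obtain \<phi> where \<phi>: "tait_coloring m M \<phi>" and s_eq: "\<And>k. s k = klein_of (\<phi> (Semi k))"
    using s by (rule statesE) (rule that)
  obtain d where d: "d \<in> {1, 2, 3}" "\<delta> = klein_of d" using klein_of_surj \<delta> by metis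
  interpret colored_pole m M \<phi> using pole \<phi> by unfold_locales
  have "\<phi> (Semi p) \<noteq> d" using \<delta> d s_eq by auto
  then obtain X q where q: "q \<noteq> p" and X: "kempe_chain d X p q"
    using ex_kempe_chain[OF d(1) p] by metis
  define t where "t k = klein_of (if Semi k \<in> X then 6 - d - \<phi> (Semi k) else \<phi> (Semi k))" for k
  have qX: "Semi q \<in> X" using kempe_chainD(5)[OF X] by blast
  then have qm: "q \<in> {1..m}" using kempe_chainD(1)[OF X] by blast
  have "t \<in> states m M"
    unfolding states_def t_def using tait_coloring_switch[OF d(1) X] by auto
  moreover have "switched m p q \<delta> s t"
    unfolding switched_def
  proof
    fix k assume k: "k \<in> {1..m}"
    \<comment> \<open>The new colour is the third one, which in the group is the sum of the other
      two.\<close>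
    have "klein_of (6 - d - \<phi> (Semi k)) = klein_of (\<phi> (Semi k)) + klein_of d" if "Semi k \<in> X"
    proof -
      have "\<phi> (Semi k) \<in> {1, 2, 3}" "\<phi> (Semi k) \<noteq> d"
        using color_range[OF kempe_chainD(1)[OF X that]] kempe_chainD(2)[OF X that] .
      then show ?thesis using d(1) by (intro klein_of_third) auto
    qed
    then show "t k = (if k = p \<or> k = q then s k + \<delta> else s k)"
      using kempe_chainD(5)[OF X, of k] by (auto simp: t_def s_eq d(2))
  qed
  moreover have "s q \<noteq> \<delta>"
  proof -
    have "\<phi> (Semi q) \<noteq> d" "\<phi> (Semi q) \<in> {1, 2, 3}"
      using kempe_chainD(2)[OF X qX] color_range[OF kempe_chainD(1)[OF X qX]] .
    then show ?thesis unfolding s_eq d(2) using klein_of_inj[OF _ d(1)] by blast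
  qed
  ultimately show "\<exists>q\<in>{1..m}. q \<noteq> p \<and> s q \<noteq> \<delta> \<and> (\<exists>t\<in>states m M. switched m p q \<delta> s t)"
    using q qm by blast
qed

section \<open>The cycle is dominated by no small multipole\<close>

definition pred_edge :: "nat \<Rightarrow> nat \<Rightarrow> nat" where
  "pred_edge m v = (if v = 1 then m else v - 1)"

text \<open>Edge \<open>e\<close> leads from vertex \<open>e\<close> to the next vertex on the
  circle, so the edges at \<open>v\<close> are \<open>v\<close> and \<open>pred_edge m v\<close>;
  for \<open>m = 1\<close> they coincide in a loop.\<close>

definition cycle_pole :: "nat \<Rightarrow> multipole" where
  "cycle_pole m = \<lparr>verts = {1..m}, edges = {1..m},
     ends = (\<lambda>e. {#e, if e = m then 1 else e + 1#}), attach = Vertex\<rparr>"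

lemma cycle_pole_simps [simp]:
  "verts (cycle_pole m) = {1..m}" "edges (cycle_pole m) = {1..m}"
  "attach (cycle_pole m) = Vertex"
  "ends (cycle_pole m) e = {#e, if e = m then 1 else e + 1#}"
  by (simp_all add: cycle_pole_def)

lemma next_eq_iff:
  "e \<in> {1..m} \<Longrightarrow> v \<in> {1..m} \<Longrightarrow> (if e = m then 1 else e + 1) = v \<longleftrightarrow> e = pred_edge m v"
  by (auto simp: pred_edge_def)

lemma pred_edge_range: "v \<in> {1..m} \<Longrightarrow> pred_edge m v \<in> {1..m}"
  by (auto simp: pred_edge_def)

text \<open>The two indicators are added so that the loop at \<open>m = 1\<close> is counted
  twice.\<close>

lemma count_cycle_pole:
  assumes "e \<in> {1..m}" "v \<in> {1..m}"
  shows "count (ends (cycle_pole m) e) v =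
    (if e = v then 1 else 0) + (if e = pred_edge m v then 1 else 0)"
  using next_eq_iff[OF assms] by auto

lemma m_pole_cycle_pole:
  assumes "m \<ge> 1"
  shows "m_pole m (cycle_pole m)"
proof -
  have "(\<Sum>e\<in>{1..m}. count (ends (cycle_pole m) e) v) + card {i \<in> {1..m}. Vertex i = Vertex v} = 3"
    if v: "v \<in> {1..m}" for v
  proof -
    have "(\<Sum>e\<in>{1..m}. count (ends (cycle_pole m) e) v) =
        (\<Sum>e\<in>{1..m}. (if e = v then 1 else 0) + (if e = pred_edge m v then 1 else 0))"
      by (rule sum.cong[OF refl], rule count_cycle_pole) (use v in auto)
    also have "\<dots> = 2"
      using v pred_edge_range[OF v] by (simp add: sum.distrib)
    finally have "(\<Sum>e\<in>{1..m}. count (ends (cycle_pole m) e) v) = 2" .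
    moreover have "{i \<in> {1..m}. Vertex i = Vertex v} = {v}" using v by auto
    ultimately show ?thesis by simp
  qed
  then show ?thesis
    using assms unfolding m_pole_def by (simp del: cycle_pole_simps(4) add: cycle_pole_simps(1-3)) auto
qed

lemma incident_cycle_pole:
  assumes "v \<in> {1..m}"
  shows "incident m (cycle_pole m) v = {Edge v, Edge (pred_edge m v), Semi v}"
proof -
  have "v \<in># ends (cycle_pole m) e \<longleftrightarrow> e = v \<or> e = pred_edge m v" if "e \<in> {1..m}" for e
    using count_cycle_pole[OF that assms]
    by (simp del: cycle_pole_simps(4) flip: count_greater_zero_iff)
  then have "{e \<in> {1..m}. v \<in># ends (cycle_pole m) e} = {v, pred_edge m v}"
    using assms pred_edge_range[OF assms] by blast
  moreover have "{i \<in> {1..m}. Vertex i = Vertex v} = {v}" using assms by auto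
  ultimately show ?thesis by (simp add: incident_def insert_commute del: cycle_pole_simps(4))
qed

lemma tait_colorable_cycle_pole:
  assumes m: "m \<ge> 2"
  shows "tait_colorable m (cycle_pole m)"
proof -
  \<comment> \<open>Edges alternate between 1 and 2, except that the last edge takes 3 when
    \<open>m\<close> is odd. Each semiedge then receives the colour missing at its vertex.\<close>
  define g :: "nat \<Rightarrow> nat" where
    "g k = (if k = m \<and> odd m then 3 else if odd k then 1 else 2)" for k
  define \<phi> where "\<phi> x = (case x of Edge k \<Rightarrow> g k | Semi k \<Rightarrow> 6 - g k - g (pred_edge m k))" for x
  have g: "g k \<in> {1, 2, 3}" for k by (simp add: g_def)
  have ne: "g v \<noteq> g (pred_edge m v)" if "v \<in> {1..m}" for v
    using that m by (auto simp: g_def pred_edge_def)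
  have third: "6 - a - b \<in> {1, 2, 3} \<and> 6 - a - b \<noteq> a \<and> 6 - a - b \<noteq> b"
    if "a \<in> {1, 2, 3}" "b \<in> {1, 2, 3}" "a \<noteq> b" for a b :: nat
    using that by auto
  have "\<phi> x \<in> {1, 2, 3}" if "x \<in> links m (cycle_pole m)" for x
  proof (cases x)
    case (Edge k)
    then show ?thesis using g by (simp only: \<phi>_def link.case)
  next
    case (Semi k)
    then have "k \<in> {1..m}" using that by auto
    then show ?thesis using third[OF g g ne] Semi by (simp only: \<phi>_def link.case)
  qed
  moreover have "inj_on \<phi> (incident m (cycle_pole m) v)" if v: "v \<in> {1..m}" for v
    unfolding incident_cycle_pole[OF v] using ne[OF v] third[OF g g ne[OF v]]
    by (auto simp: inj_on_def \<phi>_def)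
  moreover have "count (ends (cycle_pole m) e) v \<le> 1" if "e \<in> {1..m}" "v \<in> {1..m}" for e v
    unfolding count_cycle_pole[OF that] using ne[OF that(2)] by auto
  ultimately have "tait_coloring m (cycle_pole m) \<phi>"
    unfolding tait_coloring_def by (simp del: cycle_pole_simps(4))
  then show ?thesis unfolding tait_colorable_def by blast
qed

text \<open>The colour of a semiedge is the sum of the two edge colours at its vertex, so partial
  sums telescope to \<open>h 0 + h k\<close>. They miss \<open>h 0\<close> because
  \<open>h k\<close> is nonzero, and the total is 0 because \<open>h m = h 0\<close>.\<close>

lemma cyclic_state_cycle_pole:
  assumes \<phi>: "tait_coloring m (cycle_pole m) \<phi>" and m: "m \<ge> 1"
  shows "cyclic_state m (\<lambda>k. klein_of (\<phi> (Semi k)))"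
proof -
  define h where "h k = (if k = 0 then klein_of (\<phi> (Edge m)) else klein_of (\<phi> (Edge k)))" for k
  have range: "\<phi> (Edge k) \<in> {1, 2, 3}" "\<phi> (Semi k) \<in> {1, 2, 3}" if "k \<in> {1..m}" for k
    using \<phi> that unfolding tait_coloring_def cycle_pole_simps by blast+
  have step: "klein_of (\<phi> (Semi k)) = h (k - 1) + h k" if k: "k \<in> {1..m}" for k
  proof -
    have inj: "inj_on \<phi> {Edge k, Edge (pred_edge m k), Semi k}"
      using \<phi> k unfolding tait_coloring_def cycle_pole_simps(1) incident_cycle_pole[OF k, symmetric]
      by blast
    have p: "pred_edge m k \<in> {1..m}" using pred_edge_range[OF k] .
    have "count (ends (cycle_pole m) k) k \<le> 1"
      using \<phi> k unfolding tait_coloring_def cycle_pole_simps(1,2) by blast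
    then have "pred_edge m k \<noteq> k" unfolding count_cycle_pole[OF k k] by auto
    then have "\<phi> (Edge (pred_edge m k)) \<noteq> \<phi> (Edge k)" "\<phi> (Edge (pred_edge m k)) \<noteq> \<phi> (Semi k)"
      "\<phi> (Edge k) \<noteq> \<phi> (Semi k)"
      using inj by (auto simp: inj_on_def)
    then have "klein_of (\<phi> (Semi k)) = klein_of (\<phi> (Edge (pred_edge m k))) + klein_of (\<phi> (Edge k))"
      by (intro klein_of_third range k p)
    moreover have "klein_of (\<phi> (Edge (pred_edge m k))) = h (k - 1)" "klein_of (\<phi> (Edge k)) = h k"
      using k by (auto simp: h_def pred_edge_def)
    ultimately show ?thesis by simp
  qed
  have sums: "(\<Sum>l = 1..k. klein_of (\<phi> (Semi l))) = h 0 + h k" if "k \<le> m" for k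
    using that
  proof (induction k)
    case (Suc k)
    then have "(\<Sum>l = 1..Suc k. klein_of (\<phi> (Semi l))) = h 0 + h k + (h k + h (Suc k))"
      using step[of "Suc k"] by simp
    then show ?case by (simp add: add.assoc)
  qed simp
  have "h k \<noteq> 0" if "k \<le> m" for k
    using range(1)[of k] range(1)[of m] that m klein_of_nonzero by (auto simp: h_def)
  then have "\<forall>k\<le>m. (\<Sum>l = 1..k. klein_of (\<phi> (Semi l))) \<noteq> h 0"
    using sums by simp
  moreover have "(\<Sum>l = 1..m. klein_of (\<phi> (Semi l))) = 0"
    using sums[of m] m by (simp add: h_def)
  ultimately show ?thesis
    using range(2) klein_of_nonzero unfolding cyclic_state_def by blast
qed

lemma cyclic_state_cong:
  assumes "\<And>k. k \<in> {1..m} \<Longrightarrow> s k = t k"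
  shows "cyclic_state m s \<longleftrightarrow> cyclic_state m t"
proof -
  have "sum s {1..k} = sum t {1..k}" if "k \<le> m" for k
    by (rule sum.cong) (use assms that in auto)
  then show ?thesis using assms by (auto simp: cyclic_state_def)
qed

lemma cyclic_states:
  assumes sub: "Col m N \<subseteq> Col m (cycle_pole m)" and m: "m \<ge> 1" and s: "s \<in> states m N"
  shows "cyclic_state m s"
proof -
  obtain \<phi> where \<phi>: "tait_coloring m N \<phi>" "\<And>k. s k = klein_of (\<phi> (Semi k))"
    using s by (rule statesE) (rule that)
  then have "map (\<lambda>i. \<phi> (Semi i)) [1..<m+1] \<in> Col m (cycle_pole m)"
    using sub unfolding Col_def by blast
  then obtain \<psi> where \<psi>: "tait_coloring m (cycle_pole m) \<psi>"
      "map (\<lambda>i. \<phi> (Semi i)) [1..<m+1] = map (\<lambda>i. \<psi> (Semi i)) [1..<m+1]"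
    unfolding Col_def by blast
  from \<psi>(2) have "\<phi> (Semi k) = \<psi> (Semi k)" if "k \<in> {1..m}" for k
    using that unfolding map_eq_conv by (simp only: set_upt) (simp add: less_Suc_eq_le)
  then show ?thesis
    using cyclic_state_cycle_pole[OF \<psi>(1) m] cyclic_state_cong[of m s] \<phi>(2) by simp
qed

section \<open>Multipoles with fewer vertices than semiedges\<close>

lemma few_vertices_pair:
  assumes pole: "m_pole m N" and few: "card (verts N) < m"
  obtains i j where "1 \<le> i" "i < j" "j \<le> m"
    "(\<forall>s\<in>states m N. s i = s j) \<or> (\<forall>s\<in>states m N. s i \<noteq> s j)"
proof -
  have "\<exists>i\<in>{1..m}. \<exists>j\<in>{1..m}. i \<noteq> j \<and>
    ((\<forall>s\<in>states m N. s i = s j) \<or> (\<forall>s\<in>states m N. s i \<noteq> s j))"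
  proof (cases "\<exists>i\<in>{1..m}. \<exists>j. attach N i = Semiedge j")
    case True
    then obtain i j where i: "i \<in> {1..m}" "attach N i = Semiedge j" by blast
    then have j: "j \<in> {1..m}" "j \<noteq> i" using pole unfolding m_pole_def by fastforce+
    have "\<phi> (Semi i) = \<phi> (Semi j)" if "tait_coloring m N \<phi>" for \<phi>
      using that i j unfolding tait_coloring_def by blast
    then have "s i = s j" if "s \<in> states m N" for s
      using that by (elim statesE) metis
    then show ?thesis using i j by metis
  next
    case False
    \<comment> \<open>The value 0 is a dummy: here every semiedge has a vertex. The pigeonhole
      principle then yields two semiedges at one vertex.\<close>
    define f where "f i = (case attach N i of Vertex v \<Rightarrow> v | Semiedge _ \<Rightarrow> 0)" for i
    have f: "attach N i = Vertex (f i)" if "i \<in> {1..m}" for i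
      using False that by (auto simp: f_def split: attachment.splits)
    have "f ` {1..m} \<subseteq> verts N"
    proof
      fix v assume "v \<in> f ` {1..m}"
      then obtain i where "i \<in> {1..m}" "v = f i" by blast
      then show "v \<in> verts N" using pole f[of i] unfolding m_pole_def by fastforce
    qed
    moreover have "finite (verts N)" using pole by (simp add: m_pole_def)
    ultimately have "\<not> inj_on f {1..m}"
      using few card_inj_on_le[of f "{1..m}" "verts N"] by auto
    then obtain i j where ij: "i \<in> {1..m}" "j \<in> {1..m}" "i \<noteq> j" "f i = f j"
      unfolding inj_on_def by blast
    have v: "f i \<in> verts N" using \<open>f ` {1..m} \<subseteq> verts N\<close> ij by blast
    have "Semi i \<in> incident m N (f i)" "Semi j \<in> incident m N (f i)"
      using f ij by (auto simp: incident_def)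
    then have "\<phi> (Semi i) \<noteq> \<phi> (Semi j)" if "tait_coloring m N \<phi>" for \<phi>
      using that v ij(3) unfolding tait_coloring_def by (metis inj_onD link.inject(2))
    moreover have "\<phi> (Semi k) \<in> {1, 2, 3}" if "tait_coloring m N \<phi>" "k \<in> {1..m}" for \<phi> k
      using that unfolding tait_coloring_def by blast
    ultimately have "s i \<noteq> s j" if "s \<in> states m N" for s
      using that klein_of_inj ij(1,2) by (elim statesE) metis
    then show ?thesis using ij by blast
  qed
  then obtain i j where ij: "i \<in> {1..m}" "j \<in> {1..m}" "i \<noteq> j"
    "(\<forall>s\<in>states m N. s i = s j) \<or> (\<forall>s\<in>states m N. s i \<noteq> s j)"
    by blast
  show ?thesis
  proof (cases "i < j")
    case True
    then show ?thesis using that[of i j] ij by auto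
  next
    case False
    then show ?thesis using that[of j i] ij by (metis atLeastAtMost_iff linorder_neqE_nat)
  qed
qed

lemma card_verts_ge:
  assumes "m \<ge> 5" and N: "m_pole m N" "Col m N \<noteq> {}" "Col m N \<subseteq> Col m (cycle_pole m)"
  shows "card (verts N) \<ge> m"
proof (rule ccontr)
  assume "\<not> card (verts N) \<ge> m"
  then obtain i j where ij: "1 \<le> i" "i < j" "j \<le> m"
      and pair: "(\<forall>s\<in>states m N. s i = s j) \<or> (\<forall>s\<in>states m N. s i \<noteq> s j)"
    using few_vertices_pair[OF N(1)] by (metis not_le)
  interpret cyclic_pair m "states m N" i j
    using kempe_closed_states[OF N(1)] cyclic_states[OF N(3)] ij assms(1) by unfold_locales auto
  have ne: "states m N \<noteq> {}" using N(2) by (auto simp: states_def Col_def)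
  from pair show False
  proof
    assume "\<forall>s\<in>states m N. s i = s j"
    then show False by (intro equal_False[OF _ assms(1) ne]) blast
  next
    assume "\<forall>s\<in>states m N. s i \<noteq> s j"
    then show False by (intro distinct_False[OF _ assms(1) ne]) blast
  qed
qed

theorem mainTheorem6:
  fixes m :: nat
  assumes "m \<ge> 5"
  shows "max_irreducible_order m \<ge> m"
proof -
  define A where "A N \<longleftrightarrow> m_pole m N \<and> Col m N \<noteq> {} \<and> Col m N \<subseteq> Col m (cycle_pole m)" for N
  have "A (cycle_pole m)"
    using m_pole_cycle_pole[of m] tait_colorable_cycle_pole[of m] assms
    by (auto simp: A_def tait_colorable_def Col_def)
  then obtain N where N: "A N" and least: "\<And>N'. A N' \<Longrightarrow> card (verts N) \<le> card (verts N')"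
    using ex_has_least_nat[of A _ "\<lambda>N. card (verts N)"] by blast
  \<comment> \<open>A multipole reducing \<open>N\<close> would satisfy \<open>A\<close>, by
    transitivity of inclusion, and have fewer vertices.\<close>
  have "\<not> reducible_pole m N"
    using N least unfolding reducible_pole_def A_def by (metis not_le order_trans)
  moreover have "tait_colorable m N"
    using N by (auto simp: A_def tait_colorable_def Col_def)
  ultimately have "card (verts N) \<in> irreducible_orders m"
    using N unfolding irreducible_orders_def A_def by blast
  then have "card (verts N) \<le> max_irreducible_order m"
    unfolding max_irreducible_order_def by (rule Max_ge[OF finite_irreducible_orders])
  moreover have "m \<le> card (verts N)"
    using card_verts_ge assms N by (simp add: A_def)
  ultimately show ?thesis by simp
qed

end
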